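(* Periodic isotopy equivalence is an equivalence relation on the set of proper linear $3$-periodic nets in $\mathbb{R}^3$.
   Context: A (proper) linear 3-periodic net in $\mathbb{R}^3$ is a pair $\mathcal{N}=(N,S)$ where (i) $S$, the set of edges, is a countable set of line segments $[p,q]$, $p\ne q$, which are essentially disjoint (two distinct segments meet at most in a common endpoint); (ii) $N$, the set of nodes, is the set of endpoints of members of $S$; (iii) there is a basis $\underline{a}=\{a_1,a_2,a_3\}$ of $\mathbb{R}^3$ such that $N$ and $S$ are invariant under the group $\mathcal{T}$ of translations by integer combinations of $a_1,a_2,a_3$; (iv) $N$ and $S$ partition into finitely many $\mathcal{T}$-orbits. Such a basis is called a periodicity basis for $\mathcal{N}$. Nets are not required to be connected. The body $|\mathcal{N}|$ is the union of the segments in $S$. Proper linear 3-periodic nets $\mathcal{N}_0,\mathcal{N}_1$ are periodically isotopic (periodic isotopy equivalent) if there is a family of proper linear 3-periodic nets $\mathcal{N}_t$, $0<t<1$, such that (a) there is a continuous path of bases of $\mathbb{R}^3$, $t\mapsto\underline{a}^t$, $0\le t\le1$, where $\underline{a}^t$ is a right-handed periodicity basis for $\mathcal{N}_t$; (b) there are bijective functions $f_t:|\mathcal{N}_0|\to|\mathcal{N}_t|$, $0\le t\le1$, which map nodes to nodes, such that (i) $f_0$ is the identity map on $|\mathcal{N}_0|$, (ii) for each node $p$ of $\mathcal{N}_0$ the map $t\mapsto f_t(p)$ is continuous, (iii) the restriction of $f_t$ to each edge $[a,b]$ is the unique affine map onto the image edge $[f_t(a),f_t(b)]$ of $\mathcal{N}_t$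 determined by linear interpolation. *)

theory Defs
  imports "HOL-Analysis.Analysis"
begin

type_synonym net = "(real^3) set \<times> (real^3) set set"

abbreviation nodes :: "net \<Rightarrow> (real^3) set" where "nodes \<equiv> fst"
abbreviation edges :: "net \<Rightarrow> (real^3) set set" where "edges \<equiv> snd"

definition body :: "net \<Rightarrow> (real^3) set"
  where "body \<N> = \<Union>(edges \<N>)"

definition line_segment :: "(real^3) set \<Rightarrow> bool"
  where "line_segment s \<longleftrightarrow> (\<exists>p q. p \<noteq> q \<and> s = closed_segment p q)"

definition endpoints :: "(real^3) set \<Rightarrow> (real^3) set"
  where "endpoints s = {p. \<exists>q. q \<noteq> p \<and> s = closed_segment p q}"

definition essentially_disjoint :: "(real^3) set set \<Rightarrow> bool"
  where "essentially_disjoint S \<longleftrightarrow>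
    (\<forall>s\<in>S. \<forall>s'\<in>S. s \<noteq> s' \<longrightarrow>
       s \<inter> s' = {} \<or> (\<exists>x \<in> endpoints s \<inter> endpoints s'. s \<inter> s' = {x}))"

text \<open>A triple of vectors is given as \<open>a :: real^3^3\<close>, the vectors being the rows
  \<open>a $ 1\<close>, \<open>a $ 2\<close>, \<open>a $ 3\<close>; injectivity excludes repeated vectors, which
  independence of the set of rows alone would not.\<close>

definition is_basis :: "real^3^3 \<Rightarrow> bool"
  where "is_basis a \<longleftrightarrow>
    inj (($) a) \<and> independent (range (($) a)) \<and> span (range (($) a)) = UNIV"

definition right_handed :: "real^3^3 \<Rightarrow> bool"
  where "right_handed a \<longleftrightarrow> det a > 0"

definition translation_lattice :: "real^3^3 \<Rightarrow> (real^3) set"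
  where "translation_lattice a = {(\<Sum>i\<in>UNIV. of_int (c i) *\<^sub>R a $ i) | c :: 3 \<Rightarrow> int. True}"

definition translation_invariant :: "real^3^3 \<Rightarrow> net \<Rightarrow> bool"
  where "translation_invariant a \<N> \<longleftrightarrow>
    (\<forall>v \<in> translation_lattice a. (+) v ` nodes \<N> = nodes \<N> \<and> (`) ((+) v) ` edges \<N> = edges \<N>)"

definition node_orbits :: "real^3^3 \<Rightarrow> net \<Rightarrow> (real^3) set set"
  where "node_orbits a \<N> = {{v + p | v. v \<in> translation_lattice a} | p. p \<in> nodes \<N>}"

definition edge_orbits :: "real^3^3 \<Rightarrow> net \<Rightarrow> (real^3) set set set"
  where "edge_orbits a \<N> = {{(+) v ` s | v. v \<in> translation_lattice a} | s. s \<in> edges \<N>}"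

definition periodicity_basis :: "real^3^3 \<Rightarrow> net \<Rightarrow> bool"
  where "periodicity_basis a \<N> \<longleftrightarrow>
    is_basis a \<and> translation_invariant a \<N> \<and>
    finite (node_orbits a \<N>) \<and> finite (edge_orbits a \<N>)"

definition proper_linear_3_periodic_net :: "net \<Rightarrow> bool"
  where "proper_linear_3_periodic_net \<N> \<longleftrightarrow>
    countable (edges \<N>) \<and> (\<forall>s \<in> edges \<N>. line_segment s) \<and>
    essentially_disjoint (edges \<N>) \<and>
    nodes \<N> = (\<Union>s \<in> edges \<N>. endpoints s) \<and>
    (\<exists>a. periodicity_basis a \<N>)"

text \<open>The isotopy functions are total functions on \<open>real^3\<close>; only their values on
  \<open>body \<N>0\<close> are constrained. The last condition says that the map takes each edge
  \<open>[p, q]\<close> to the edge \<open>[f p, f q]\<close> of the target by linear interpolation.\<close>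

definition net_bijection :: "net \<Rightarrow> net \<Rightarrow> (real^3 \<Rightarrow> real^3) \<Rightarrow> bool"
  where "net_bijection \<N>0 \<N>1 f \<longleftrightarrow>
    bij_betw f (body \<N>0) (body \<N>1) \<and>
    f ` nodes \<N>0 \<subseteq> nodes \<N>1 \<and>
    (\<forall>p q. closed_segment p q \<in> edges \<N>0 \<longrightarrow>
       closed_segment (f p) (f q) \<in> edges \<N>1 \<and>
       (\<forall>u\<in>{0..1}. f ((1 - u) *\<^sub>R p + u *\<^sub>R q) = (1 - u) *\<^sub>R f p + u *\<^sub>R f q))"

definition periodically_isotopic :: "net \<Rightarrow> net \<Rightarrow> bool"
  where "periodically_isotopic \<N>0 \<N>1 \<longleftrightarrow>
    (\<exists>(\<N> :: real \<Rightarrow> net) (a :: real \<Rightarrow> real^3^3) (f :: real \<Rightarrow> real^3 \<Rightarrow> real^3).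
       \<N> 0 = \<N>0 \<and> \<N> 1 = \<N>1 \<and>
       (\<forall>t\<in>{0..1}. proper_linear_3_periodic_net (\<N> t)) \<and>
       continuous_on {0..1} a \<and>
       (\<forall>t\<in>{0..1}. periodicity_basis (a t) (\<N> t) \<and> right_handed (a t)) \<and>
       (\<forall>t\<in>{0..1}. net_bijection \<N>0 (\<N> t) (f t)) \<and>
       (\<forall>x \<in> body \<N>0. f 0 x = x) \<and>
       (\<forall>p \<in> nodes \<N>0. continuous_on {0..1} (\<lambda>t. f t p)))"

end

theory Submission
  imports Defs
begin

text \<open>Reflexivity is the constant isotopy, and symmetry is time reversal
  \<open>t \<mapsto> f\<^bsub>1-t\<^esub> \<circ> f\<^sub>1\<inverse>\<close>. For the latter the inverse of a net bijection has to be a net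
  bijection. A net bijection is only required to send edges to edges, but essential
  disjointness makes it surjective on edges: the midpoint of a target edge lies on the image of
  some edge, and two distinct edges share no point that is not an endpoint
  (\<open>net_bijection_edge_preimage\<close>).

  The content of the theorem is transitivity. Concatenating isotopies \<open>\<N> \<rightarrow> \<M>\<close> and \<open>\<M> \<rightarrow> \<K>\<close>
  causes no trouble for the nets and the bijections, but at the junction the first path of bases
  ends in a periodicity basis \<open>a\<close> of \<open>\<M>\<close> and the second one starts in a possibly different
  periodicity basis \<open>b\<close>, so that the path of bases would jump. The remedy is to pass to a common
  sublattice. If \<open>\<M>\<close> has a node \<open>p\<close> and \<open>d\<close> is a period in the lattice of \<open>a\<close>, then the
  infinitely many nodes \<open>p + n d\<close> lie in finitely many orbits of the lattice of \<open>b\<close>, so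
  some positive multiple of \<open>d\<close> lies in that lattice. Hence \<open>m a = B b\<close> for a positive integer
  \<open>m\<close> and an integral matrix \<open>B\<close> (\<open>commensurable_periodicity_bases\<close>). Such a change of basis,
  with constant coefficients, can be applied along a whole isotopy: the new lattice has finite
  index in the old one, so orbits split into finitely many orbits, and \<open>det B > 0\<close>
  because \<open>a\<close> and \<open>b\<close> are both right-handed (\<open>isotopy_coarsen\<close>). After replacing the path
  \<open>a\<^sub>t\<close> by \<open>m a\<^sub>t\<close> and \<open>b\<^sub>t\<close> by \<open>B b\<^sub>t\<close> the two paths of bases meet.

  A net without nodes is empty, has no commensurability constraint between its periodicity bases,
  and is isotopic only to itself; for it transitivity reduces to reflexivity.\<close>

section \<open>Bases and lattices\<close>

definition integral_matrix :: "real^3^3 \<Rightarrow> bool"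
  where "integral_matrix B \<longleftrightarrow> (\<forall>i j. B $ i $ j \<in> \<int>)"

lemma integral_matrix_scaled_identity: "integral_matrix (real k *\<^sub>R mat 1)"
  by (auto simp: integral_matrix_def mat_def)

lemma rows_eq_range: "rows a = range (($) (a :: real^3^3))"
  by (auto simp: rows_def row_def vec_lambda_eta)

lemma is_basis_iff_det_nonzero: "is_basis a \<longleftrightarrow> det a \<noteq> 0"
proof
  assume "is_basis a"
  then have "span (rows a) = UNIV"
    by (simp add: is_basis_def rows_eq_range)
  then obtain B where "B ** a = mat 1"
    using matrix_left_invertible_span_rows by blast
  then show "det a \<noteq> 0"
    by (metis det_I det_mul mult_zero_right zero_neq_one)
next
  assume nz: "det a \<noteq> 0"
  then have "span (rows a) = UNIV"
    unfolding matrix_left_invertible_span_rows[symmetric]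
    using invertible_det_nz invertible_left_inverse by blast
  moreover have "independent (rows a)"
    using nz det_dependent_rows[of a] dependent_vec_eq by metis
  moreover have "inj (($) a)"
    using nz det_identical_rows[of _ _ a]
    by (auto simp: inj_def row_def vec_lambda_eta)
  ultimately show "is_basis a"
    by (simp add: is_basis_def rows_eq_range)
qed

text \<open>Multiplication of row vectors turns changes of basis into matrix products: the lattice of
  \<open>B ** a\<close> consists of the vectors \<open>(c v* B) v* a\<close>.\<close>
lemma translation_lattice_iff:
  "v \<in> translation_lattice a \<longleftrightarrow> (\<exists>c::real^3. (\<forall>i. c $ i \<in> \<int>) \<and> v = c v* a)"
proof
  assume "v \<in> translation_lattice a"
  then obtain c :: "3 \<Rightarrow> int" where "v = (\<Sum>i\<in>UNIV. of_int (c i) *\<^sub>R a $ i)"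
    by (auto simp: translation_lattice_def)
  then have "v = (\<chi> i. of_int (c i)) v* a"
    by (simp add: vec_eq_iff vector_matrix_mult_def mult.commute)
  then show "\<exists>c::real^3. (\<forall>i. c $ i \<in> \<int>) \<and> v = c v* a"
    by (intro exI[of _ "\<chi> i. of_int (c i)"]) simp
next
  assume "\<exists>c::real^3. (\<forall>i. c $ i \<in> \<int>) \<and> v = c v* a"
  then obtain c :: "real^3" where c: "\<forall>i. c $ i \<in> \<int>" "v = c v* a"
    by blast
  have "v = (\<Sum>i\<in>UNIV. of_int \<lfloor>c $ i\<rfloor> *\<^sub>R a $ i)"
    using c by (simp add: vec_eq_iff vector_matrix_mult_def mult.commute)
  then show "v \<in> translation_lattice a"
    unfolding translation_lattice_def by (intro CollectI exI[of _ "\<lambda>i. \<lfloor>c $ i\<rfloor>"]) simp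
qed

lemma translation_lattice_zero: "0 \<in> translation_lattice a"
  unfolding translation_lattice_iff by (intro exI[of _ 0]) simp

lemma translation_lattice_basis_vector: "a $ i \<in> translation_lattice a"
  unfolding translation_lattice_iff
  by (intro exI[of _ "axis i 1"])
     (auto simp: axis_def vec_eq_iff vector_matrix_mult_def if_distrib if_distribR cong: if_cong)

lemma translation_lattice_add:
  assumes "u \<in> translation_lattice a" "v \<in> translation_lattice a"
  shows "u + v \<in> translation_lattice a"
proof -
  obtain c d :: "real^3" where "\<forall>i. c $ i \<in> \<int>" "u = c v* a" "\<forall>i. d $ i \<in> \<int>" "v = d v* a"
    using assms unfolding translation_lattice_iff by blast
  then show ?thesis
    unfolding translation_lattice_iff
    by (intro exI[of _ "c + d"]) (simp add: vector_matrix_left_distrib)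
qed

lemma translation_lattice_scale:
  assumes "v \<in> translation_lattice a" "r \<in> \<int>"
  shows "r *\<^sub>R v \<in> translation_lattice a"
proof -
  obtain c :: "real^3" where "\<forall>i. c $ i \<in> \<int>" "v = c v* a"
    using assms unfolding translation_lattice_iff by blast
  then show ?thesis
    unfolding translation_lattice_iff using assms(2)
    by (intro exI[of _ "r *\<^sub>R c"]) (simp add: scaleR_vector_matrix_assoc)
qed

lemma translation_lattice_diff:
  assumes "u \<in> translation_lattice a" "v \<in> translation_lattice a"
  shows "u - v \<in> translation_lattice a"
  using translation_lattice_add[OF assms(1) translation_lattice_scale[OF assms(2), of "-1"]]
  by simp

lemma translation_lattice_integral_mult:
  assumes "integral_matrix B"
  shows "translation_lattice (B ** a) \<subseteq> translation_lattice a"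
proof
  fix v assume "v \<in> translation_lattice (B ** a)"
  then obtain c :: "real^3" where c: "\<forall>i. c $ i \<in> \<int>" "v = c v* (B ** a)"
    unfolding translation_lattice_iff by blast
  have "\<forall>i. (c v* B) $ i \<in> \<int>"
    using assms c(1) by (auto simp: vector_matrix_mult_def integral_matrix_def intro!: Ints_sum Ints_mult)
  then show "v \<in> translation_lattice a"
    unfolding translation_lattice_iff using c(2) by (metis vector_matrix_mul_assoc)
qed

text \<open>An integral matrix \<open>C\<close> that inverts \<open>B\<close> up to the factor \<open>r\<close> witnesses that
  the sublattice of \<open>B ** a\<close> has finite index: it contains \<open>r\<close> times the full lattice.\<close>
lemma translation_lattice_quasi_inverse:
  assumes "integral_matrix C" "C ** B = r *\<^sub>R mat 1" "v \<in> translation_lattice a"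
  shows "r *\<^sub>R v \<in> translation_lattice (B ** a)"
proof -
  have "r *\<^sub>R v \<in> translation_lattice (r *\<^sub>R a)"
    using assms(3) unfolding translation_lattice_iff by (metis vector_scaleR_matrix_ac)
  also have "r *\<^sub>R a = C ** (B ** a)"
    by (simp add: matrix_mul_assoc assms(2) flip: scalar_matrix_assoc)
  finally show ?thesis
    using translation_lattice_integral_mult[OF assms(1)] by blast
qed

section \<open>Coarsening and comparing periodicity bases\<close>

text \<open>Division with remainder by \<open>k\<close> in each coordinate writes a lattice vector as an element of
  the second lattice plus one of \<open>k\<^sup>3\<close> remainders, so each orbit of the first lattice splits into
  at most \<open>k\<^sup>3\<close> orbits of the second. The action \<open>g\<close> is left abstract in order to treat
  translation of nodes and translation of edges alike.\<close>
lemma finite_orbits_sublattice: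
  fixes g :: "real^3 \<Rightarrow> 'b \<Rightarrow> 'b"
  assumes zero: "\<And>x. g 0 x = x"
    and add: "\<And>u v x. g (u + v) x = g u (g v x)"
    and k: "k > 0"
    and sub: "\<And>v. v \<in> translation_lattice a \<Longrightarrow> real k *\<^sub>R v \<in> translation_lattice b"
    and fin: "finite {{g v x | v. v \<in> translation_lattice a} | x. x \<in> X}"
  shows "finite {{g v x | v. v \<in> translation_lattice b} | x. x \<in> X}"
proof -
  define orb where "orb d x = {g v x | v. v \<in> translation_lattice d}" for d x
  \<comment> \<open>\<open>Q\<close> is the set of remainders; \<open>rep\<close> picks a point in each orbit of the first lattice.\<close>
  define Q where "Q = (\<lambda>c. \<Sum>i\<in>UNIV. of_int (c i) *\<^sub>R a $ i) ` (UNIV \<rightarrow>\<^sub>E {0..<int k})"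
  define rep where "rep Y = (SOME x. x \<in> X \<and> orb a x = Y)" for Y
  have "finite Q"
    unfolding Q_def by (intro finite_imageI finite_PiE) auto
  have orb_shift_subset: "orb b (g w y) \<subseteq> orb b y" if "w \<in> translation_lattice b" for w y
  proof
    fix z assume "z \<in> orb b (g w y)"
    then obtain u where "u \<in> translation_lattice b" "z = g u (g w y)"
      by (auto simp: orb_def)
    then have "u + w \<in> translation_lattice b" "z = g (u + w) y"
      using that by (simp_all add: translation_lattice_add add)
    then show "z \<in> orb b y"
      unfolding orb_def by (intro CollectI exI[of _ "u + w"]) simp
  qed
  have orb_shift: "orb b (g w y) = orb b y" if w: "w \<in> translation_lattice b" for w y
  proof (rule equalityI[OF orb_shift_subset[OF w]])
    have "g (- w) (g w y) = y"
      using add[of "- w" w y] zero by simp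
    moreover have "- w \<in> translation_lattice b"
      using translation_lattice_diff[OF translation_lattice_zero w] by simp
    ultimately show "orb b y \<subseteq> orb b (g w y)"
      using orb_shift_subset[of "- w" "g w y"] by simp
  qed
  have "orb b x \<in> (\<lambda>(Y, q). orb b (g q (rep Y))) ` (orb a ` X \<times> Q)" if x: "x \<in> X" for x
  proof -
    have "rep (orb a x) \<in> X \<and> orb a (rep (orb a x)) = orb a x"
      unfolding rep_def by (rule someI_ex) (use x in blast)
    moreover have "x \<in> orb a x"
      unfolding orb_def using translation_lattice_zero[of a] zero[of x]
      by (intro CollectI exI[of _ 0]) simp
    ultimately obtain y where y: "y = rep (orb a x)" "x \<in> orb a y"
      by simp
    then obtain c :: "3 \<Rightarrow> int" where c: "x = g (\<Sum>i\<in>UNIV. of_int (c i) *\<^sub>R a $ i) y"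
      unfolding orb_def translation_lattice_def by blast
    define q where "q = (\<Sum>i\<in>UNIV. of_int (c i mod int k) *\<^sub>R a $ i)"
    define w where "w = real k *\<^sub>R (\<Sum>i\<in>UNIV. of_int (c i div int k) *\<^sub>R a $ i)"
    have "real_of_int (c i) = real k * of_int (c i div int k) + of_int (c i mod int k)" for i
      by (metis mult_div_mod_eq of_int_add of_int_mult of_int_of_nat_eq)
    then have "(\<Sum>i\<in>UNIV. of_int (c i) *\<^sub>R a $ i) = w + q"
      unfolding w_def q_def scaleR_sum_right sum.distrib[symmetric]
      by (intro sum.cong) (simp_all add: scaleR_add_left)
    then have "x = g w (g q y)"
      using c add[of w q y] by simp
    moreover have "w \<in> translation_lattice b"
      unfolding w_def by (intro sub) (auto simp: translation_lattice_def)
    ultimately have "orb b x = orb b (g q y)"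
      using orb_shift[of w "g q y"] by simp
    moreover have "q \<in> Q"
      unfolding Q_def q_def using k by (intro image_eqI[of _ _ "\<lambda>i. c i mod int k"]) auto
    ultimately show ?thesis
      using x y(1) by (intro image_eqI[of _ _ "(orb a x, q)"]) auto
  qed
  then have "orb b ` X \<subseteq> (\<lambda>(Y, q). orb b (g q (rep Y))) ` (orb a ` X \<times> Q)"
    by blast
  moreover have "finite (orb a ` X)"
    using fin by (simp add: orb_def Setcompr_eq_image)
  ultimately have "finite (orb b ` X)"
    using \<open>finite Q\<close> by (meson finite_SigmaI finite_imageI finite_subset)
  then show ?thesis
    by (simp add: orb_def Setcompr_eq_image)
qed

lemma periodicity_basis_integral_mult:
  assumes a: "periodicity_basis a \<N>"
    and B: "integral_matrix B" and C: "integral_matrix C"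
    and k: "k > 0" and CB: "C ** B = real k *\<^sub>R mat 1"
  shows "periodicity_basis (B ** a) \<N>"
proof -
  have sub: "real k *\<^sub>R v \<in> translation_lattice (B ** a)" if "v \<in> translation_lattice a" for v
    using translation_lattice_quasi_inverse[OF C CB that] .
  have "((1 / real k) *\<^sub>R C) ** B = mat 1"
    using k by (simp add: CB flip: scalar_matrix_assoc)
  then have "det B \<noteq> 0"
    by (metis det_I det_mul mult_zero_right zero_neq_one)
  then have "is_basis (B ** a)"
    using a by (simp add: periodicity_basis_def is_basis_iff_det_nonzero det_mul)
  moreover have "translation_invariant (B ** a) \<N>"
    using a translation_lattice_integral_mult[OF B, of a]
    unfolding periodicity_basis_def translation_invariant_def by blast
  moreover have "finite (node_orbits (B ** a) \<N>)"
    unfolding node_orbits_def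
    by (rule finite_orbits_sublattice[where g = "(+)", OF _ _ k sub])
       (use a in \<open>auto simp: periodicity_basis_def node_orbits_def add.assoc\<close>)
  moreover have "finite (edge_orbits (B ** a) \<N>)"
    unfolding edge_orbits_def
    by (rule finite_orbits_sublattice[where g = "\<lambda>v. (`) ((+) v)", OF _ _ k sub])
       (use a in \<open>auto simp: periodicity_basis_def edge_orbits_def add.assoc image_image\<close>)
  ultimately show ?thesis
    by (simp add: periodicity_basis_def)
qed

text \<open>The nodes \<open>p + n d\<close> are infinitely many and lie in finitely many orbits, so two of them are
  in the same orbit and differ by a vector of the other lattice.\<close>
lemma multiple_in_other_lattice:
  assumes a: "translation_invariant a \<N>" and b: "finite (node_orbits b \<N>)"
    and p: "p \<in> nodes \<N>" and d: "d \<in> translation_lattice a"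
  obtains k :: nat where "k > 0" "real k *\<^sub>R d \<in> translation_lattice b"
proof -
  define h where "h n = {v + (real n *\<^sub>R d + p) | v. v \<in> translation_lattice b}" for n :: nat
  have "real n *\<^sub>R d + p \<in> nodes \<N>" for n :: nat
    using a p translation_lattice_scale[OF d, of "real n"] unfolding translation_invariant_def by force
  then have "range h \<subseteq> node_orbits b \<N>"
    by (auto simp: h_def node_orbits_def)
  then have "\<not> inj h"
    using b finite_subset infinite_UNIV_nat finite_imageD by blast
  then obtain i j where "i \<noteq> j" "h i = h j"
    by (auto simp: inj_def)
  then obtain m n where mn: "m < n" "h m = h n"
    by (cases i j rule: linorder_cases) auto
  have "real n *\<^sub>R d + p \<in> h n"
    using translation_lattice_zero[of b] by (force simp: h_def)
  then obtain v where v: "v \<in> translation_lattice b" "real n *\<^sub>R d + p = v + (real m *\<^sub>R d + p)"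
    using mn(2) unfolding h_def by blast
  have "real (n - m) *\<^sub>R d = v"
    using v(2) mn(1) by (simp add: of_nat_diff algebra_simps)
  then show ?thesis
    using that[of "n - m"] v(1) mn(1) by simp
qed

lemma multiple_of_basis_is_integral_mult:
  assumes a: "periodicity_basis a \<N>" and b: "periodicity_basis b \<N>" and p: "nodes \<N> \<noteq> {}"
  obtains m :: nat and B where "m > 0" "integral_matrix B" "real m *\<^sub>R a = B ** b"
proof -
  have "\<exists>k::nat. k > 0 \<and> real k *\<^sub>R a $ i \<in> translation_lattice b" for i
  proof -
    obtain q where "q \<in> nodes \<N>"
      using p by blast
    from multiple_in_other_lattice[OF _ _ this translation_lattice_basis_vector, of a b i] a b
    show ?thesis
      unfolding periodicity_basis_def by blast
  qed
  then obtain k :: "3 \<Rightarrow> nat" where k: "\<And>i. k i > 0" "\<And>i. real (k i) *\<^sub>R a $ i \<in> translation_lattice b"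
    by metis
  define m where "m = (\<Prod>i\<in>UNIV. k i)"
  have "real m *\<^sub>R a $ i \<in> translation_lattice b" for i
  proof -
    have "real m *\<^sub>R a $ i = real (\<Prod>j\<in>UNIV - {i}. k j) *\<^sub>R (real (k i) *\<^sub>R a $ i)"
      using prod.remove[of UNIV i k] by (simp add: m_def mult.commute)
    then show ?thesis
      using translation_lattice_scale[OF k(2)] Ints_of_nat by metis
  qed
  then obtain c :: "3 \<Rightarrow> real^3" where c: "\<And>i j. c i $ j \<in> \<int>" "\<And>i. real m *\<^sub>R a $ i = c i v* b"
    unfolding translation_lattice_iff by metis
  show ?thesis
  proof (rule that)
    show "m > 0"
      unfolding m_def using k(1) by (simp add: prod_pos)
    show "integral_matrix (\<chi> i. c i)"
      using c(1) by (simp add: integral_matrix_def)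
    show "real m *\<^sub>R a = (\<chi> i. c i) ** b"
      using c(2) by (simp add: vec_eq_iff matrix_matrix_mult_def vector_matrix_mult_def mult.commute)
  qed
qed

text \<open>Expressing multiples of \<open>a\<close> through \<open>b\<close> and multiples of \<open>b\<close> through \<open>a\<close> gives, besides the
  common sublattice, the matrix \<open>C\<close> that certifies its finite index. The certificate does not
  mention the bases, so it stays valid when they move along an isotopy.\<close>
lemma commensurable_periodicity_bases:
  assumes a: "periodicity_basis a \<N>" and b: "periodicity_basis b \<N>" and p: "nodes \<N> \<noteq> {}"
  obtains m n :: nat and B C where "m > 0" "n > 0" "integral_matrix B" "integral_matrix C"
    "real m *\<^sub>R a = B ** b" "C ** B = real n *\<^sub>R mat 1"
proof -
  obtain m B where m: "m > 0" "integral_matrix B" "real m *\<^sub>R a = B ** b"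
    using multiple_of_basis_is_integral_mult[OF a b p] .
  obtain k C where k: "k > 0" "integral_matrix C" "real k *\<^sub>R b = C ** a"
    using multiple_of_basis_is_integral_mult[OF b a p] .
  have "det b \<noteq> 0"
    using b by (simp add: periodicity_basis_def is_basis_iff_det_nonzero)
  then obtain b' where b': "b ** b' = mat 1"
    using invertible_det_nz invertible_right_inverse by blast
  \<comment> \<open>The rows of \<open>b\<close> are independent, so the identity \<open>(C ** B) ** b = k m b\<close> can be cancelled.\<close>
  have "(C ** B) ** b = C ** (real m *\<^sub>R a)"
    by (simp add: m(3) matrix_mul_assoc)
  also have "\<dots> = real (k * m) *\<^sub>R b"
    by (simp add: matrix_scalar_ac mult.commute flip: k(3) scalar_matrix_assoc)
  finally have "(C ** B) ** (b ** b') = real (k * m) *\<^sub>R (b ** b')"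
    by (simp add: matrix_mul_assoc scalar_matrix_assoc)
  then have "C ** B = real (k * m) *\<^sub>R mat 1"
    by (simp add: b')
  then show ?thesis
    using that[of m "k * m" B C] m k by simp
qed

lemma right_handed_periodicity_basis_exists:
  assumes "proper_linear_3_periodic_net \<N>"
  obtains a where "periodicity_basis a \<N>" "right_handed a"
proof -
  obtain a where a: "periodicity_basis a \<N>"
    using assms by (auto simp: proper_linear_3_periodic_net_def)
  \<comment> \<open>In odd dimension the point reflection reverses the orientation and fixes every lattice.\<close>
  define B :: "real^3^3" where "B = (-1) *\<^sub>R mat 1"
  have B: "integral_matrix B" "det B = -1"
    by (simp_all add: B_def integral_matrix_def mat_def det_3)
  have BB: "B ** B = real 1 *\<^sub>R mat 1"
    unfolding B_def matrix_scalar_ac scalar_matrix_assoc[symmetric] by simp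
  have "det a \<noteq> 0"
    using a by (simp add: periodicity_basis_def is_basis_iff_det_nonzero)
  then have "right_handed a \<or> right_handed (B ** a)"
    by (auto simp: right_handed_def det_mul B(2))
  then show ?thesis
    using that a periodicity_basis_integral_mult[OF a B(1) B(1) _ BB] by auto
qed

section \<open>Edges and net bijections\<close>

lemma proper_net_edge_segment:
  assumes "proper_linear_3_periodic_net \<N>" "s \<in> edges \<N>"
  obtains p q where "p \<noteq> q" "s = closed_segment p q"
  using assms by (auto simp: proper_linear_3_periodic_net_def line_segment_def)

lemma edge_subset_body: "s \<in> edges \<N> \<Longrightarrow> s \<subseteq> body \<N>"
  by (auto simp: body_def)

lemma endpoints_subset: "endpoints s \<subseteq> s"
  by (auto simp: endpoints_def)

lemma node_in_body:
  assumes "proper_linear_3_periodic_net \<N>" "p \<in> nodes \<N>"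
  shows "p \<in> body \<N>"
  using assms endpoints_subset by (fastforce simp: proper_linear_3_periodic_net_def body_def)

lemma edge_ends:
  assumes "proper_linear_3_periodic_net \<N>" "closed_segment p q \<in> edges \<N>"
  shows "p \<noteq> q" "p \<in> nodes \<N>" "q \<in> nodes \<N>"
    "p \<in> body \<N>" "q \<in> body \<N>"
proof -
  obtain x y where "x \<noteq> y" "closed_segment p q = closed_segment x y"
    using proper_net_edge_segment[OF assms] by metis
  then show "p \<noteq> q"
    by auto
  then have "p \<in> endpoints (closed_segment p q)" "q \<in> endpoints (closed_segment p q)"
    by (auto simp: endpoints_def closed_segment_commute)
  then show pq: "p \<in> nodes \<N>" "q \<in> nodes \<N>"
    using assms by (auto simp: proper_linear_3_periodic_net_def)
  show "p \<in> body \<N>" "q \<in> body \<N>"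
    using pq node_in_body[OF assms(1)] by auto
qed

lemma endpoints_closed_segment: "p \<noteq> q \<Longrightarrow> endpoints (closed_segment p q) = {p, q}"
  by (auto simp: endpoints_def closed_segment_eq doubleton_eq_iff)

lemma node_obtains_edge:
  assumes "proper_linear_3_periodic_net \<N>" "p \<in> nodes \<N>"
  obtains q where "closed_segment p q \<in> edges \<N>"
  using assms by (auto simp: proper_linear_3_periodic_net_def endpoints_def)

lemma essentially_disjointD:
  assumes "proper_linear_3_periodic_net \<N>" "s \<in> edges \<N>" "s' \<in> edges \<N>" "s \<noteq> s'"
  shows "s \<inter> s' = {} \<or> (\<exists>x \<in> endpoints s \<inter> endpoints s'. s \<inter> s' = {x})"
  using assms by (simp add: proper_linear_3_periodic_net_def essentially_disjoint_def)

lemma net_bijection_affine: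
  assumes "net_bijection \<N> \<M> f" "closed_segment p q \<in> edges \<N>" "u \<in> {0..1}"
  shows "f ((1 - u) *\<^sub>R p + u *\<^sub>R q) = (1 - u) *\<^sub>R f p + u *\<^sub>R f q"
  using assms by (simp add: net_bijection_def)

lemma net_bijection_edge:
  assumes "net_bijection \<N> \<M> f" "closed_segment p q \<in> edges \<N>"
  shows "closed_segment (f p) (f q) \<in> edges \<M>"
  using assms by (simp add: net_bijection_def)

lemma net_bijection_edge_image:
  assumes "net_bijection \<N> \<M> f" "closed_segment p q \<in> edges \<N>"
  shows "f ` closed_segment p q = closed_segment (f p) (f q)"
  unfolding closed_segment_image_interval image_image
  using net_bijection_affine[OF assms] by (intro image_cong) auto

lemma net_bijection_id: "net_bijection \<N> \<N> (\<lambda>x. x)"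
  by (auto simp: net_bijection_def bij_betw_def)

lemma net_bijection_compose:
  assumes "net_bijection \<N> \<M> f" "net_bijection \<M> \<K> g"
  shows "net_bijection \<N> \<K> (\<lambda>x. g (f x))"
proof -
  have "bij_betw (\<lambda>x. g (f x)) (body \<N>) (body \<K>)"
    using bij_betw_trans[of f "body \<N>" "body \<M>" g "body \<K>"] assms
    by (simp add: net_bijection_def comp_def)
  then show ?thesis
    using assms unfolding net_bijection_def by (simp add: image_subset_iff)
qed

text \<open>The midpoint \<open>z\<close> of a target edge is hit by some point of the source body. The edge carrying
  that point is mapped onto an edge through \<open>z\<close>, and by essential disjointness this can only
  be the given one; the affine map may run through it in either direction.\<close>
lemma net_bijection_edge_preimage:
  assumes N: "proper_linear_3_periodic_net \<N>" and M: "proper_linear_3_periodic_net \<M>"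
    and f: "net_bijection \<N> \<M> f" and e: "closed_segment p q \<in> edges \<M>"
  obtains x y where "closed_segment x y \<in> edges \<N>" "f x = p" "f y = q"
proof -
  have pq: "p \<noteq> q"
    using edge_ends[OF M e] by simp
  define z where "z = midpoint p q"
  have z: "z \<in> closed_segment p q" "z \<notin> endpoints (closed_segment p q)"
    using pq by (auto simp: z_def endpoints_closed_segment)
  then have "z \<in> f ` body \<N>"
    using f edge_subset_body[OF e] by (auto simp: net_bijection_def bij_betw_def)
  then obtain s w where s: "s \<in> edges \<N>" "w \<in> s" "f w = z"
    by (auto simp: body_def)
  obtain x y where xy: "s = closed_segment x y"
    using proper_net_edge_segment[OF N s(1)] by metis
  have e': "closed_segment x y \<in> edges \<N>"
    using s xy by simp
  have z': "z \<in> closed_segment (f x) (f y)"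
    using net_bijection_edge_image[OF f e'] s xy by blast
  have "closed_segment p q = closed_segment (f x) (f y)"
  proof (rule ccontr)
    assume "closed_segment p q \<noteq> closed_segment (f x) (f y)"
    then obtain v where "v \<in> endpoints (closed_segment p q)"
        "closed_segment p q \<inter> closed_segment (f x) (f y) = {v}"
      using essentially_disjointD[OF M e net_bijection_edge[OF f e']] z(1) z' by blast
    then show False
      using z z' by (metis IntI singletonD)
  qed
  then have "{f x, f y} = {p, q}"
    by (simp add: closed_segment_eq)
  then consider "f x = p" "f y = q" | "f y = p" "f x = q"
    by (auto simp: doubleton_eq_iff)
  then show ?thesis
  proof cases
    case 1
    then show ?thesis
      using that e' by blast
  next
    case 2
    then show ?thesis
      using that[of y x] e' by (simp add: closed_segment_commute)
  qed
qed

lemma net_bijection_inverse: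
  assumes N: "proper_linear_3_periodic_net \<N>" and M: "proper_linear_3_periodic_net \<M>"
    and f: "net_bijection \<N> \<M> f"
  shows "net_bijection \<M> \<N> (inv_into (body \<N>) f)"
proof -
  define g where "g = inv_into (body \<N>) f"
  have bij: "bij_betw f (body \<N>) (body \<M>)"
    using f by (simp add: net_bijection_def)
  have gf: "g (f x) = x" if "x \<in> body \<N>" for x
    using bij that by (simp add: g_def bij_betw_def)
  have edge: "closed_segment (g p) (g q) \<in> edges \<N> \<and>
      (\<forall>u\<in>{0..1}. g ((1 - u) *\<^sub>R p + u *\<^sub>R q) = (1 - u) *\<^sub>R g p + u *\<^sub>R g q)"
    if e: "closed_segment p q \<in> edges \<M>" for p q
  proof -
    obtain x y where xy: "closed_segment x y \<in> edges \<N>" "f x = p" "f y = q"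
      using net_bijection_edge_preimage[OF N M f e] .
    have g: "g p = x" "g q = y"
      using gf edge_ends[OF N xy(1)] xy(2,3) by auto
    have "g ((1 - u) *\<^sub>R p + u *\<^sub>R q) = (1 - u) *\<^sub>R x + u *\<^sub>R y" if u: "u \<in> {0..1}" for u
    proof -
      have "(1 - u) *\<^sub>R x + u *\<^sub>R y \<in> body \<N>"
        using u edge_subset_body[OF xy(1)] by (auto simp: closed_segment_def)
      from gf[OF this] show ?thesis
        using net_bijection_affine[OF f xy(1) u] xy(2,3) by simp
    qed
    then show ?thesis
      using xy(1) g by simp
  qed
  have "g ` nodes \<M> \<subseteq> nodes \<N>"
  proof clarify
    fix p assume "p \<in> nodes \<M>"
    then obtain q where "closed_segment p q \<in> edges \<M>"
      using node_obtains_edge[OF M] by blast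
    then show "g p \<in> nodes \<N>"
      using edge edge_ends[OF N] by blast
  qed
  moreover have "bij_betw g (body \<M>) (body \<N>)"
    using bij bij_betw_inv_into by (auto simp: g_def)
  ultimately show ?thesis
    using edge by (simp add: net_bijection_def flip: g_def)
qed

section \<open>Operations on isotopies\<close>

text \<open>The conditions on the data of a periodic isotopy, named so that isotopies can be reversed,
  rebased and concatenated as explicit families.\<close>
definition isotopy :: "(real \<Rightarrow> net) \<Rightarrow> (real \<Rightarrow> real^3^3) \<Rightarrow> (real \<Rightarrow> real^3 \<Rightarrow> real^3) \<Rightarrow> bool"
  where "isotopy \<N> a f \<longleftrightarrow>
    (\<forall>t\<in>{0..1}. proper_linear_3_periodic_net (\<N> t)) \<and>
    continuous_on {0..1} a \<and>
    (\<forall>t\<in>{0..1}. periodicity_basis (a t) (\<N> t) \<and> right_handed (a t)) \<and>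
    (\<forall>t\<in>{0..1}. net_bijection (\<N> 0) (\<N> t) (f t)) \<and>
    (\<forall>x \<in> body (\<N> 0). f 0 x = x) \<and>
    (\<forall>p \<in> nodes (\<N> 0). continuous_on {0..1} (\<lambda>t. f t p))"

lemma periodically_isotopic_iff:
  "periodically_isotopic \<N>0 \<N>1 \<longleftrightarrow> (\<exists>\<N> a f. isotopy \<N> a f \<and> \<N> 0 = \<N>0 \<and> \<N> 1 = \<N>1)"
  unfolding periodically_isotopic_def isotopy_def by blast

lemma isotopy_imp_periodically_isotopic:
  "isotopy \<N> a f \<Longrightarrow> periodically_isotopic (\<N> 0) (\<N> 1)"
  unfolding periodically_isotopic_iff by blast

lemma isotopyD:
  assumes "isotopy \<N> a f"
  shows "continuous_on {0..1} a"
    and "x \<in> body (\<N> 0) \<Longrightarrow> f 0 x = x"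
    and "p \<in> nodes (\<N> 0) \<Longrightarrow> continuous_on {0..1} (\<lambda>t. f t p)"
  using assms by (simp_all add: isotopy_def)

lemma isotopy_atD:
  assumes "isotopy \<N> a f" "t \<in> {0..1}"
  shows "proper_linear_3_periodic_net (\<N> t)" "periodicity_basis (a t) (\<N> t)"
    "right_handed (a t)" "net_bijection (\<N> 0) (\<N> t) (f t)"
  using assms by (simp_all add: isotopy_def)

lemma isotopyI:
  assumes "\<And>t. t \<in> {0..1} \<Longrightarrow> proper_linear_3_periodic_net (\<N> t)"
    and "continuous_on {0..1} a"
    and "\<And>t. t \<in> {0..1} \<Longrightarrow> periodicity_basis (a t) (\<N> t)"
    and "\<And>t. t \<in> {0..1} \<Longrightarrow> right_handed (a t)"
    and "\<And>t. t \<in> {0..1} \<Longrightarrow> net_bijection (\<N> 0) (\<N> t) (f t)"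
    and "\<And>x. x \<in> body (\<N> 0) \<Longrightarrow> f 0 x = x"
    and "\<And>p. p \<in> nodes (\<N> 0) \<Longrightarrow> continuous_on {0..1} (\<lambda>t. f t p)"
  shows "isotopy \<N> a f"
  using assms by (simp add: isotopy_def)

lemma isotopy_const:
  assumes "proper_linear_3_periodic_net \<N>" "periodicity_basis a \<N>" "right_handed a"
  shows "isotopy (\<lambda>_. \<N>) (\<lambda>_. a) (\<lambda>_ x. x)"
  using assms by (simp add: isotopy_def net_bijection_id)

lemma isotopy_reverse:
  assumes iso: "isotopy \<N> a f"
  shows "isotopy (\<lambda>t. \<N> (1 - t)) (\<lambda>t. a (1 - t))
    (\<lambda>t x. f (1 - t) (inv_into (body (\<N> 0)) (f 1) x))"
proof -
  define g where "g = inv_into (body (\<N> 0)) (f 1)"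
  have f1: "net_bijection (\<N> 0) (\<N> 1) (f 1)"
    using isotopy_atD(4)[OF iso, of 1] by simp
  have g: "net_bijection (\<N> 1) (\<N> 0) g"
    unfolding g_def using isotopy_atD(1)[OF iso] f1 by (intro net_bijection_inverse) auto
  have cont_reverse: "continuous_on {0..1} (\<lambda>t. h (1 - t))" if "continuous_on {0..1} h"
    for h :: "real \<Rightarrow> 'b::topological_space"
    by (rule continuous_on_compose2[OF that]) (auto intro!: continuous_intros)
  have "isotopy (\<lambda>t. \<N> (1 - t)) (\<lambda>t. a (1 - t)) (\<lambda>t x. f (1 - t) (g x))"
  proof (rule isotopyI)
    fix t :: real assume "t \<in> {0..1}"
    then have t: "1 - t \<in> {0..1}"
      by simp
    note at = isotopy_atD[OF iso t]
    show "proper_linear_3_periodic_net (\<N> (1 - t))" "periodicity_basis (a (1 - t)) (\<N> (1 - t))"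
      "right_handed (a (1 - t))"
      by (fact at)+
    show "net_bijection (\<N> (1 - 0)) (\<N> (1 - t)) (\<lambda>x. f (1 - t) (g x))"
      using net_bijection_compose[OF g at(4)] by simp
  next
    fix x assume "x \<in> body (\<N> (1 - 0))"
    then show "f (1 - 0) (g x) = x"
      using f1 by (simp add: g_def net_bijection_def bij_betw_def f_inv_into_f)
  next
    fix p assume "p \<in> nodes (\<N> (1 - 0))"
    then have "g p \<in> nodes (\<N> 0)"
      using g by (auto simp: net_bijection_def)
    then show "continuous_on {0..1} (\<lambda>t. f (1 - t) (g p))"
      using isotopyD(3)[OF iso] cont_reverse by blast
  qed (rule cont_reverse[OF isotopyD(1)[OF iso]])
  then show ?thesis
    by (simp add: g_def)
qed

text \<open>The nets and the bijections do not depend on the choice of periods, so the path of bases can be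
  replaced by a path of bases of sublattices of constant index.\<close>
lemma isotopy_coarsen:
  assumes iso: "isotopy \<N> a f"
    and B: "integral_matrix B" and C: "integral_matrix C"
    and k: "k > 0" "C ** B = real k *\<^sub>R mat 1" and pos: "det B > 0"
  shows "isotopy \<N> (\<lambda>t. B ** a t) f"
proof (rule isotopyI)
  show "continuous_on {0..1} (\<lambda>t. B ** a t)"
    unfolding matrix_matrix_mult_def by (intro continuous_intros isotopyD(1)[OF iso])
  fix t :: real assume t: "t \<in> {0..1}"
  show "periodicity_basis (B ** a t) (\<N> t)"
    using periodicity_basis_integral_mult[OF isotopy_atD(2)[OF iso t] B C k] .
  show "right_handed (B ** a t)"
    using isotopy_atD(3)[OF iso t] pos by (simp add: right_handed_def det_mul)
qed (fact isotopy_atD[OF iso] isotopyD[OF iso])+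

lemma isotopy_join:
  assumes N: "isotopy \<N> a f" and M: "isotopy \<M> b g"
    and NM: "\<N> 1 = \<M> 0" and ab: "a 1 = b 0"
  shows "isotopy (\<lambda>t. if t \<le> 1/2 then \<N> (2*t) else \<M> (2*t - 1)) (a +++ b)
    (\<lambda>t. if t \<le> 1/2 then f (2*t) else (\<lambda>x. g (2*t - 1) (f 1 x)))"
    (is "isotopy ?K _ ?h")
proof (rule isotopyI)
  have f: "net_bijection (\<N> 0) (\<M> 0) (f 1)"
    using isotopy_atD(4)[OF N, of 1] by (simp add: NM)
  {
    fix t :: real assume t: "t \<in> {0..1}"
    consider "t \<le> 1/2" "2*t \<in> {0..1}" | "\<not> t \<le> 1/2" "2*t - 1 \<in> {0..1}"
      using t by fastforce
    then have "proper_linear_3_periodic_net (?K t) \<and> periodicity_basis ((a +++ b) t) (?K t) \<and>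
        right_handed ((a +++ b) t) \<and> net_bijection (\<N> 0) (?K t) (?h t)"
    proof cases
      case 1
      then show ?thesis
        using isotopy_atD[OF N 1(2)] by (simp add: joinpaths_def)
    next
      case 2
      then show ?thesis
        using isotopy_atD[OF M 2(2)] net_bijection_compose[OF f] by (simp add: joinpaths_def)
    qed
  }
  note at = this
  show "continuous_on {0..1} (a +++ b)"
    using path_join_imp[of a b] isotopyD(1)[OF N] isotopyD(1)[OF M] ab
    by (simp add: path_def pathfinish_def pathstart_def)
  fix t :: real assume t: "t \<in> {0..1}"
  show "proper_linear_3_periodic_net (?K t)" "periodicity_basis ((a +++ b) t) (?K t)"
    "right_handed ((a +++ b) t)"
    using at[OF t] by blast+
  show "net_bijection (?K 0) (?K t) (?h t)"
    using at[OF t] by simp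
next
  fix x assume "x \<in> body (?K 0)"
  then show "?h 0 x = x"
    using isotopyD(2)[OF N] by simp
next
  fix p assume "p \<in> nodes (?K 0)"
  then have p: "p \<in> nodes (\<N> 0)"
    by simp
  \<comment> \<open>The two branches agree at the junction because \<open>g\<close> starts as the identity on the body of \<open>\<M> 0\<close>.\<close>
  have f1p: "f 1 p \<in> nodes (\<M> 0)"
    using isotopy_atD(4)[OF N, of 1] p by (auto simp: NM net_bijection_def)
  then have "g 0 (f 1 p) = f 1 p"
    using isotopyD(2)[OF M] node_in_body isotopy_atD(1)[OF M, of 0] by simp
  then have "path ((\<lambda>t. f t p) +++ (\<lambda>t. g t (f 1 p)))"
    using isotopyD(3)[OF N p] isotopyD(3)[OF M f1p]
    by (intro path_join_imp) (simp_all add: path_def pathfinish_def pathstart_def)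
  moreover have "(\<lambda>t. f t p) +++ (\<lambda>t. g t (f 1 p)) = (\<lambda>t. ?h t p)"
    by (simp add: joinpaths_def fun_eq_iff)
  ultimately show "continuous_on {0..1} (\<lambda>t. ?h t p)"
    by (simp add: path_def)
qed

section \<open>The equivalence relation\<close>

lemma net_with_empty_body:
  assumes "proper_linear_3_periodic_net \<N>" "body \<N> = {}"
  shows "\<N> = ({}, {})"
proof -
  have "s \<notin> edges \<N>" for s
    using proper_net_edge_segment[OF assms(1), of s] edge_subset_body[of s \<N>] assms(2) by auto
  then have "edges \<N> = {}"
    by blast
  then show ?thesis
    using assms(1) by (simp add: proper_linear_3_periodic_net_def prod_eq_iff)
qed

lemma body_empty_if_no_nodes:
  assumes "proper_linear_3_periodic_net \<N>" "nodes \<N> = {}"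
  shows "body \<N> = {}"
proof -
  have "s \<notin> edges \<N>" for s
  proof
    assume s: "s \<in> edges \<N>"
    obtain p q where "s = closed_segment p q"
      using proper_net_edge_segment[OF assms(1) s] .
    then show False
      using edge_ends(2)[OF assms(1), of p q] s assms(2) by simp
  qed
  then show ?thesis
    by (auto simp: body_def)
qed

lemma periodically_isotopic_body_empty:
  assumes "periodically_isotopic \<N> \<M>"
  shows "body \<N> = {} \<longleftrightarrow> body \<M> = {}"
proof -
  obtain \<K> a f where "isotopy \<K> a f" "\<K> 0 = \<N>" "\<K> 1 = \<M>"
    using assms unfolding periodically_isotopic_iff by blast
  then have "bij_betw (f 1) (body \<N>) (body \<M>)"
    using isotopy_atD(4)[of \<K> a f 1] by (simp add: net_bijection_def)
  then show ?thesis
    by (auto simp: bij_betw_def)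
qed

lemma periodically_isotopic_refl:
  assumes "proper_linear_3_periodic_net \<N>"
  shows "periodically_isotopic \<N> \<N>"
proof -
  obtain a where "periodicity_basis a \<N>" "right_handed a"
    using right_handed_periodicity_basis_exists[OF assms] .
  from isotopy_imp_periodically_isotopic[OF isotopy_const[OF assms this]] show ?thesis .
qed

lemma periodically_isotopic_sym:
  assumes "periodically_isotopic \<N> \<M>"
  shows "periodically_isotopic \<M> \<N>"
proof -
  obtain \<K> a f where K: "isotopy \<K> a f" "\<K> 0 = \<N>" "\<K> 1 = \<M>"
    using assms unfolding periodically_isotopic_iff by blast
  from isotopy_imp_periodically_isotopic[OF isotopy_reverse[OF K(1)]] show ?thesis
    by (simp add: K)
qed

lemma periodically_isotopic_trans:
  assumes NM: "periodically_isotopic \<N> \<M>" and MK: "periodically_isotopic \<M> \<K>"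
  shows "periodically_isotopic \<N> \<K>"
proof -
  obtain P a f where P: "isotopy P a f" "P 0 = \<N>" "P 1 = \<M>"
    using NM unfolding periodically_isotopic_iff by blast
  obtain Q b g where Q: "isotopy Q b g" "Q 0 = \<M>" "Q 1 = \<K>"
    using MK unfolding periodically_isotopic_iff by blast
  have proper: "proper_linear_3_periodic_net \<N>" "proper_linear_3_periodic_net \<M>"
    "proper_linear_3_periodic_net \<K>"
    using isotopy_atD(1)[OF P(1), of 0] isotopy_atD(1)[OF P(1), of 1] isotopy_atD(1)[OF Q(1), of 1]
      P(2,3) Q(3) by simp_all
  show ?thesis
  proof (cases "nodes \<M> = {}")
    case True
    then have "body \<N> = {}" "body \<K> = {}"
      using periodically_isotopic_body_empty[OF NM] periodically_isotopic_body_empty[OF MK]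
        body_empty_if_no_nodes[OF proper(2)] by auto
    then have "\<N> = \<K>"
      using net_with_empty_body proper by metis
    then show ?thesis
      using periodically_isotopic_refl[OF proper(1)] by simp
  next
    case False
    have a: "periodicity_basis (a 1) \<M>" "det (a 1) > 0"
      using isotopy_atD(2,3)[OF P(1), of 1] P(3) by (simp_all add: right_handed_def)
    have b: "periodicity_basis (b 0) \<M>" "det (b 0) > 0"
      using isotopy_atD(2,3)[OF Q(1), of 0] Q(2) by (simp_all add: right_handed_def)
    obtain m n B C where m: "m > 0" and n: "n > 0"
      and B: "integral_matrix B" and C: "integral_matrix C"
      and eq: "real m *\<^sub>R a 1 = B ** b 0" and CB: "C ** B = real n *\<^sub>R mat 1"
      using commensurable_periodicity_bases[OF a(1) b(1) False] .
    \<comment> \<open>Scaling by \<open>m\<close> is written as a matrix so that both halves are coarsened in the same way.\<close>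
    define A :: "real^3^3" where "A = real m *\<^sub>R mat 1"
    have A: "integral_matrix A" "mat 1 ** A = real m *\<^sub>R mat 1" "integral_matrix (mat 1)"
      using integral_matrix_scaled_identity[of m] integral_matrix_scaled_identity[of 1]
      by (auto simp: A_def)
    have detA: "det A > 0"
      using m by (simp add: A_def det_3 mat_def)
    have eq': "A ** a 1 = B ** b 0"
      by (simp add: A_def eq flip: scalar_matrix_assoc)
    then have "det B * det (b 0) > 0"
      using detA a(2) by (metis det_mul mult_pos_pos)
    then have detB: "det B > 0"
      using b(2) by (simp add: zero_less_mult_iff)
    have "isotopy (\<lambda>t. if t \<le> 1/2 then P (2*t) else Q (2*t - 1))
        ((\<lambda>t. A ** a t) +++ (\<lambda>t. B ** b t))
        (\<lambda>t. if t \<le> 1/2 then f (2*t) else (\<lambda>x. g (2*t - 1) (f 1 x)))"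
      by (rule isotopy_join[OF isotopy_coarsen[OF P(1) A(1,3) m A(2) detA]
            isotopy_coarsen[OF Q(1) B C n CB detB]]) (simp_all add: P Q eq')
    from isotopy_imp_periodically_isotopic[OF this] show ?thesis
      by (simp add: P Q)
  qed
qed

theorem theorem6p2:
  shows "equiv {\<N>. proper_linear_3_periodic_net \<N>}
    {(\<N>0, \<N>1). proper_linear_3_periodic_net \<N>0 \<and> proper_linear_3_periodic_net \<N>1 \<and>
       periodically_isotopic \<N>0 \<N>1}"
    (is "equiv _ ?R")
proof (rule equivI)
  show "refl_on {\<N>. proper_linear_3_periodic_net \<N>} ?R"
    by (rule refl_onI) (simp add: periodically_isotopic_refl)
  show "sym ?R"
    by (rule symI) (use periodically_isotopic_sym in blast)
  show "trans ?R"
    by (rule transI) (use periodically_isotopic_trans in blast)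
qed blast

end
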